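(* Let $n,k\in\mathbb{Z}_{\ge 1}$. For any permutation $\pi$ of $[n]$, the skewed $k$-tree $\mathcal{T}^{\pi,k}$ has size $n^{O(k)}$ and satisfies the following properties: 1. for each subset $J\subseteq[n]$ of $k'\le k$ variables, there is exactly one leaf $v\in\mathrm{leaves}(\mathcal{T}^{\pi,k})$ such that $J_v^1=J$; and 2. for any leaf $v\in\mathrm{leaves}(\mathcal{T}^{\pi,k})$, either $|J_v^1|=k$ or $J_v^0\cup J_v^1=[n]$.
   Context: $[n]=\{1,\dots,n\}$. A branch-and-bound (BB) tree $\mathcal{T}$ (on variables $x_1,\dots,x_n$) is a rooted binary tree in which each node has $0$ or $2$ children. Each node $v$ carries a set $C_v$ of branching constraints. The root has $C_{\mathrm{root}}=\emptyset$. If a node $v$ has two children, they are obtained by branching on a variable $x_j$, $j\in[n]$, not already branched on at an ancestor of $v$: one child has branching constraints $C_v\cup\{x_j=0\}$ and the other $C_v\cup\{x_j=1\}$. The size $|\mathcal{T}|$ is the number of nodes. For a node $v$, $J_v^0:=\{j:\{x_j=0\}\in C_v\}$ and $J_v^1:=\{j:\{x_j=1\}\in C_v\}$. Skewed $k$-tree $\mathcal{T}^{\pi,k}$: Let $\mathcal{T}_0$ consist of only the root. For $i=1,\dots,n$ in order, $\mathcal{T}_i$ is obtained from $\mathcal{T}_{i-1}$ by branching on variable $x_{\pi(i)}$ at every leaf $v\in\mathrm{leaves}(\mathcal{T}_{i-1})$ with $|J_v^1|<k$ (other leaves are left unchanged). Set $\mathcal{T}^{\pi,k}:=\mathcal{T}_n$.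 "Size $n^{O(k)}$" means: there is an absolute constant $C$ such that $|\mathcal{T}^{\pi,k}|\le n^{Ck}$ for all $n\ge 2$, all $k\ge1$ and all permutations $\pi$ of $[n]$. *)

theory Defs
  imports "HOL-Combinatorics.Permutations"
begin

text \<open>
  In \<open>Branch j l r\<close>, the subtree \<open>l\<close> belongs to \<open>x\<^sub>j = 0\<close> and \<open>r\<close> to \<open>x\<^sub>j = 1\<close>.
  A node is identified with its path from the root: \<open>False\<close> means going to the 0-child,
  \<open>True\<close> to the 1-child. Distinct nodes thus remain distinct, whatever their constraints.
\<close>

datatype bb_tree = Leaf | Branch nat bb_tree bb_tree

type_synonym node = "bool list"

text \<open>The tree branches on variables from \<open>V\<close> only, on none twice along any path.\<close>

primrec bb_tree_on :: "nat set \<Rightarrow> bb_tree \<Rightarrow> bool" where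
  "bb_tree_on V Leaf \<longleftrightarrow> True"
| "bb_tree_on V (Branch j l r) \<longleftrightarrow> j \<in> V \<and> bb_tree_on (V - {j}) l \<and> bb_tree_on (V - {j}) r"

primrec nodes :: "bb_tree \<Rightarrow> node set" where
  "nodes Leaf = {[]}"
| "nodes (Branch j l r) = {[]} \<union> Cons False ` nodes l \<union> Cons True ` nodes r"

primrec leaves :: "bb_tree \<Rightarrow> node set" where
  "leaves Leaf = {[]}"
| "leaves (Branch j l r) = Cons False ` leaves l \<union> Cons True ` leaves r"

text \<open>The generated \<open>size\<close> of the datatype does not count leaves, hence a separate notion.\<close>

definition bb_size :: "bb_tree \<Rightarrow> nat" where
  "bb_size t = card (nodes t)"

text \<open>
  The set \<open>C\<^sub>v\<close>: the pair \<open>(j, False)\<close> stands for \<open>x\<^sub>j = 0\<close>, and \<open>(j, True)\<close> for \<open>x\<^sub>j = 1\<close>.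
  The last equation only concerns paths that leave the tree.
\<close>

fun constraints :: "bb_tree \<Rightarrow> node \<Rightarrow> (nat \<times> bool) set" where
  "constraints t [] = {}"
| "constraints (Branch j l r) (b # v) = insert (j, b) (constraints (if b then r else l) v)"
| "constraints Leaf (b # v) = {}"

definition J0 :: "bb_tree \<Rightarrow> node \<Rightarrow> nat set" where
  "J0 t v = {j. (j, False) \<in> constraints t v}"

definition J1 :: "bb_tree \<Rightarrow> node \<Rightarrow> nat set" where
  "J1 t v = {j. (j, True) \<in> constraints t v}"

text \<open>Branch on \<open>x\<^sub>j\<close> at every leaf \<open>v\<close> with \<open>P v\<close>.\<close>

primrec branch_leaves :: "nat \<Rightarrow> (node \<Rightarrow> bool) \<Rightarrow> bb_tree \<Rightarrow> bb_tree" where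
  "branch_leaves j P Leaf = (if P [] then Branch j Leaf Leaf else Leaf)"
| "branch_leaves j P (Branch i l r) =
     Branch i (branch_leaves j (\<lambda>v. P (False # v)) l) (branch_leaves j (\<lambda>v. P (True # v)) r)"

primrec skewed_stage :: "(nat \<Rightarrow> nat) \<Rightarrow> nat \<Rightarrow> nat \<Rightarrow> bb_tree" where
  "skewed_stage \<pi> k 0 = Leaf"
| "skewed_stage \<pi> k (Suc i) =
     (let t = skewed_stage \<pi> k i in branch_leaves (\<pi> (Suc i)) (\<lambda>v. card (J1 t v) < k) t)"

definition skewed_tree :: "nat \<Rightarrow> (nat \<Rightarrow> nat) \<Rightarrow> nat \<Rightarrow> bb_tree" where
  "skewed_tree n \<pi> k = skewed_stage \<pi> k n"

lemma bb_tree_on_branch_leaves: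
  "bb_tree_on V t \<Longrightarrow> j \<notin> V \<Longrightarrow> bb_tree_on (insert j V) (branch_leaves j P t)"
proof (induction t arbitrary: V P)
  case (Branch i l r)
  then have i: "i \<in> V" and l: "bb_tree_on (V - {i}) l" and r: "bb_tree_on (V - {i}) r"
    and j: "j \<notin> V - {i}"
    by simp_all
  have eq: "insert j V - {i} = insert j (V - {i})"
    using i Branch.prems(2) by blast
  show ?case
    unfolding branch_leaves.simps bb_tree_on.simps eq
    using i Branch.IH(1)[OF l j] Branch.IH(2)[OF r j] by blast
qed simp

lemma bb_tree_on_skewed_tree:
  assumes "\<pi> permutes {1..n}"
  shows "bb_tree_on {1..n} (skewed_tree n \<pi> k)"
proof -
  have "bb_tree_on (\<pi> ` {1..i}) (skewed_stage \<pi> k i)" for i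
  proof (induction i)
    case (Suc i)
    have "\<pi> (Suc i) \<notin> \<pi> ` {1..i}"
      using inj_image_mem_iff[OF permutes_inj[OF assms]] by simp
    moreover have "\<pi> ` {1..Suc i} = insert (\<pi> (Suc i)) (\<pi> ` {1..i})"
      by (simp add: atLeastAtMostSuc_conv)
    ultimately show ?case
      using bb_tree_on_branch_leaves[OF Suc] by (simp only: skewed_stage.simps Let_def)
  qed simp
  from this[of n] show ?thesis
    unfolding skewed_tree_def permutes_image[OF assms] .
qed

end

theory Submission
  imports Defs
begin

text \<open>
  After \<open>i\<close> stages the tree has branched on \<open>V = \<pi> ` {1..i}\<close>, and reading off the variables set
  to 1 puts its leaves in bijection with the subsets of \<open>V\<close> of at most \<open>k\<close> elements
  (\<open>bij_betw_J1_skewed_stage\<close>). One more stage, on a fresh variable \<open>j\<close>, preserves this: a subset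
  \<open>J\<close> of \<open>insert j V\<close> determines the leaf of \<open>J - {j}\<close> in the old tree, and that leaf is
  branched on iff \<open>J - {j}\<close> still has room for another element; if so, its two children stand for
  \<open>J - {j}\<close> and \<open>insert j J\<close>. At the last stage \<open>V = {1..n}\<close>, which is the first property.

  The second property holds because a leaf is passed over by a stage only when it already has \<open>k\<close>
  ones, and it then remains a leaf with \<open>k\<close> ones forever (\<open>leaf_full_or_all_fixed\<close>).

  The size bound is a consequence of the bijection. There are at most \<open>(n + 1) ^ k\<close> subsets of
  \<open>{1..n}\<close> with at most \<open>k\<close> elements, hence at most that many leaves, and a binary tree has fewer
  than twice as many nodes as leaves. For \<open>n \<ge> 2\<close> and \<open>k \<ge> 1\<close>, the bounds \<open>2 \<le> n ^ k\<close> and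
  \<open>n + 1 \<le> n ^ 2\<close> give \<open>2 * (n + 1) ^ k \<le> n ^ (3 * k)\<close>.
\<close>

section \<open>Counting nodes by leaves\<close>

lemma finite_leaves: "finite (leaves t)"
  by (induction t) auto

lemma finite_nodes: "finite (nodes t)"
  by (induction t) auto

lemma card_leaves_Branch: "card (leaves (Branch j l r)) = card (leaves l) + card (leaves r)"
proof -
  have "card (Cons False ` leaves l \<union> Cons True ` leaves r)
      = card (Cons False ` leaves l) + card (Cons True ` leaves r)"
    by (rule card_Un_disjoint) (auto simp: finite_leaves)
  then show ?thesis
    by (simp add: card_image)
qed

lemma card_nodes_Branch: "card (nodes (Branch j l r)) = Suc (card (nodes l) + card (nodes r))"
proof -
  have "card (Cons False ` nodes l \<union> Cons True ` nodes r)
      = card (Cons False ` nodes l) + card (Cons True ` nodes r)"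
    by (rule card_Un_disjoint) (auto simp: finite_nodes)
  moreover have "[] \<notin> Cons False ` nodes l \<union> Cons True ` nodes r"
    by auto
  ultimately show ?thesis
    by (simp add: card_image finite_nodes)
qed

lemma Suc_bb_size: "Suc (bb_size t) = 2 * card (leaves t)"
proof (induction t)
  case (Branch j l r)
  then show ?case
    unfolding bb_size_def card_leaves_Branch card_nodes_Branch by simp
qed (simp add: bb_size_def)

section \<open>Leaves and their constraints after branching\<close>

lemma leaves_branch_leaves:
  "leaves (branch_leaves j P t) =
     {v \<in> leaves t. \<not> P v} \<union> {v @ [b] | v b. v \<in> leaves t \<and> P v}"
proof (induction t arbitrary: P)
  case Leaf
  show ?case
    by (auto intro: bool.exhaust)
next
  case (Branch i l r)
  show ?case
    unfolding branch_leaves.simps leaves.simps Branch.IH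
    by (auto simp: image_iff)
qed

lemma constraints_branch_leaves_leaf:
  "v \<in> leaves t \<Longrightarrow> constraints (branch_leaves j P t) v = constraints t v"
  by (induction t arbitrary: P v) auto

lemma constraints_branch_leaves_child:
  "v \<in> leaves t \<Longrightarrow> P v \<Longrightarrow>
     constraints (branch_leaves j P t) (v @ [b]) = insert (j, b) (constraints t v)"
  by (induction t arbitrary: P v) (auto split: if_splits)

lemma J0_J1_branch_leaves:
  assumes "v \<in> leaves t"
  shows "J1 (branch_leaves j P t) v = J1 t v"
    and "P v \<Longrightarrow> J1 (branch_leaves j P t) (v @ [b]) = (if b then insert j (J1 t v) else J1 t v)"
    and "P v \<Longrightarrow> J0 (branch_leaves j P t) (v @ [b]) = (if b then J0 t v else insert j (J0 t v))"
  using assms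
  by (auto simp: J0_def J1_def constraints_branch_leaves_leaf constraints_branch_leaves_child)

section \<open>Leaves as bounded subsets of the variables\<close>

text \<open>
  Forgetting \<open>j\<close> recovers the old leaf from which a new leaf stems, so injectivity is inherited;
  the only new pairs of leaves, the two children of one leaf, are separated by \<open>j\<close> itself.
\<close>

lemma bij_betw_J1_branch_leaves:
  assumes bij: "bij_betw (J1 t) (leaves t) {J. J \<subseteq> V \<and> card J \<le> k}"
    and fin: "finite V" and fresh: "j \<notin> V"
  defines "t' \<equiv> branch_leaves j (\<lambda>v. card (J1 t v) < k) t"
  shows "bij_betw (J1 t') (leaves t') {J. J \<subseteq> insert j V \<and> card J \<le> k}"
proof -
  have J1: "J1 t v \<subseteq> V" "card (J1 t v) \<le> k" "finite (J1 t v)" "j \<notin> J1 t v"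
    if "v \<in> leaves t" for v
    using bij_betwE[OF bij] that fin fresh by (auto intro: finite_subset)
  have stem: "\<exists>v\<in>leaves t. J1 t v = J1 t' w - {j} \<and>
      (\<not> card (J1 t v) < k \<and> w = v \<or> card (J1 t v) < k \<and> w = v @ [j \<in> J1 t' w])"
    if w: "w \<in> leaves t'" for w
  proof -
    from w consider (kept) "w \<in> leaves t" "\<not> card (J1 t w) < k"
      | (child) v b where "v \<in> leaves t" "card (J1 t v) < k" "w = v @ [b]"
      unfolding t'_def leaves_branch_leaves by blast
    then show ?thesis
    proof cases
      case kept
      then have "J1 t' w = J1 t w"
        unfolding t'_def by (intro J0_J1_branch_leaves(1))
      then show ?thesis
        using kept J1(4)[OF kept(1)] by auto
    next
      case child
      then have "J1 t' w = (if b then insert j (J1 t v) else J1 t v)"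
        unfolding t'_def by (simp add: J0_J1_branch_leaves(2))
      then show ?thesis
        using child J1(4)[OF child(1)] by (intro bexI[of _ v]) auto
    qed
  qed
  have "inj_on (J1 t') (leaves t')"
  proof (rule inj_onI)
    fix w1 w2
    assume w: "w1 \<in> leaves t'" "w2 \<in> leaves t'" and eq: "J1 t' w1 = J1 t' w2"
    obtain v1 where v1: "v1 \<in> leaves t" "J1 t v1 = J1 t' w1 - {j}"
      "\<not> card (J1 t v1) < k \<and> w1 = v1 \<or> card (J1 t v1) < k \<and> w1 = v1 @ [j \<in> J1 t' w1]"
      using stem[OF w(1)] by blast
    obtain v2 where v2: "v2 \<in> leaves t" "J1 t v2 = J1 t' w2 - {j}"
      "\<not> card (J1 t v2) < k \<and> w2 = v2 \<or> card (J1 t v2) < k \<and> w2 = v2 @ [j \<in> J1 t' w2]"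
      using stem[OF w(2)] by blast
    have "v1 = v2"
      using inj_onD[OF bij_betw_imp_inj_on[OF bij]] v1(1,2) v2(1,2) eq by simp
    then show "w1 = w2"
      using v1(3) v2(3) eq by auto
  qed
  moreover have "J1 t' ` leaves t' = {J. J \<subseteq> insert j V \<and> card J \<le> k}"
  proof (intro equalityI subsetI)
    fix J assume "J \<in> J1 t' ` leaves t'"
    then obtain w where w: "w \<in> leaves t'" and J: "J = J1 t' w"
      by blast
    obtain v where v: "v \<in> leaves t" "J1 t v = J - {j}"
      and w_v: "\<not> card (J1 t v) < k \<and> w = v \<or> card (J1 t v) < k \<and> w = v @ [j \<in> J]"
      using stem[OF w] J by blast
    from w_v have "card J \<le> k"
    proof
      assume "\<not> card (J1 t v) < k \<and> w = v"
      then have "J = J1 t v"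
        using J J0_J1_branch_leaves(1)[OF v(1)] by (simp add: t'_def)
      then show ?thesis
        using J1(2)[OF v(1)] by simp
    next
      assume less: "card (J1 t v) < k \<and> w = v @ [j \<in> J]"
      have "J \<subseteq> insert j (J1 t v)"
        using v(2) by blast
      then have "card J \<le> Suc (card (J1 t v))"
        using card_mono[of "insert j (J1 t v)" J] J1(3,4)[OF v(1)] by simp
      then show ?thesis
        using less by simp
    qed
    moreover have "J \<subseteq> insert j V"
      using v(2) J1(1)[OF v(1)] by blast
    ultimately show "J \<in> {J. J \<subseteq> insert j V \<and> card J \<le> k}"
      by simp
  next
    fix J assume "J \<in> {J. J \<subseteq> insert j V \<and> card J \<le> k}"
    then have sub: "J \<subseteq> insert j V" and card: "card J \<le> k"
      by simp_all
    have finJ: "finite J"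
      using sub fin by (meson finite_insert finite_subset)
    have "J - {j} \<subseteq> V" "card (J - {j}) \<le> k"
      using sub card card_Diff1_le[of J j] by auto
    then have "J - {j} \<in> J1 t ` leaves t"
      using bij_betw_imp_surj_on[OF bij] by simp
    then obtain v where v: "v \<in> leaves t" "J1 t v = J - {j}"
      by auto
    show "J \<in> J1 t' ` leaves t'"
    proof (cases "card (J1 t v) < k")
      case True
      then have "v @ [j \<in> J] \<in> leaves t'"
        unfolding t'_def leaves_branch_leaves using v(1) by blast
      moreover have "J1 t' (v @ [j \<in> J]) = J"
        unfolding t'_def using True v by (auto simp: J0_J1_branch_leaves(2))
      ultimately show ?thesis
        by (metis imageI)
    next
      case False
      then have "v \<in> leaves t'"
        unfolding t'_def leaves_branch_leaves using v(1) by blast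
      \<comment> \<open>Since \<open>J - {j}\<close> already has \<open>k\<close> elements, \<open>J\<close> cannot contain \<open>j\<close> in addition.\<close>
      moreover have "j \<notin> J"
        using False v(2) card finJ by (metis card_Diff1_less order_less_le_trans)
      then have "J1 t' v = J"
        unfolding t'_def using v by (simp add: J0_J1_branch_leaves(1))
      ultimately show ?thesis
        by (metis imageI)
    qed
  qed
  ultimately show ?thesis
    unfolding bij_betw_def ..
qed

lemma bij_betw_J1_skewed_stage:
  assumes "inj \<pi>"
  shows "bij_betw (J1 (skewed_stage \<pi> k i)) (leaves (skewed_stage \<pi> k i))
           {J. J \<subseteq> \<pi> ` {1..i} \<and> card J \<le> k}"
proof (induction i)
  case 0
  have "{J. J \<subseteq> \<pi> ` {1..0} \<and> card J \<le> k} = {{}}"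
    by auto
  then show ?case
    by (simp add: bij_betw_def J1_def)
next
  case (Suc i)
  have "\<pi> (Suc i) \<notin> \<pi> ` {1..i}"
    using inj_image_mem_iff[OF assms] by simp
  moreover have "\<pi> ` {1..Suc i} = insert (\<pi> (Suc i)) (\<pi> ` {1..i})"
    by (simp add: atLeastAtMostSuc_conv)
  ultimately show ?case
    using bij_betw_J1_branch_leaves[OF Suc] by (simp only: skewed_stage.simps Let_def) simp
qed

lemma bij_betw_J1_skewed_tree:
  assumes "\<pi> permutes {1..n}"
  shows "bij_betw (J1 (skewed_tree n \<pi> k)) (leaves (skewed_tree n \<pi> k))
           {J. J \<subseteq> {1..n} \<and> card J \<le> k}"
  using bij_betw_J1_skewed_stage[OF permutes_inj[OF assms], of k n]
  unfolding skewed_tree_def permutes_image[OF assms] .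

text \<open>
  The inequality \<open>card (J1 t v) \<le> k\<close> from the bijection is what makes a leaf that is not branched
  on have exactly \<open>k\<close> ones.
\<close>

lemma leaf_full_or_all_fixed:
  assumes "inj \<pi>" and "v \<in> leaves (skewed_stage \<pi> k i)"
  shows "card (J1 (skewed_stage \<pi> k i) v) = k \<or>
    J0 (skewed_stage \<pi> k i) v \<union> J1 (skewed_stage \<pi> k i) v = \<pi> ` {1..i}"
  using assms(2)
proof (induction i arbitrary: v)
  case 0
  then show ?case
    by (simp add: J0_def J1_def)
next
  case (Suc i)
  define t where "t = skewed_stage \<pi> k i"
  have t': "skewed_stage \<pi> k (Suc i) = branch_leaves (\<pi> (Suc i)) (\<lambda>v. card (J1 t v) < k) t"
    by (simp add: t_def Let_def)
  from Suc.prems consider (kept) "v \<in> leaves t" "\<not> card (J1 t v) < k"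
    | (child) u b where "u \<in> leaves t" "card (J1 t u) < k" "v = u @ [b]"
    unfolding t' leaves_branch_leaves by blast
  then show ?case
  proof cases
    case kept
    have "card (J1 t v) \<le> k"
      using bij_betwE[OF bij_betw_J1_skewed_stage[OF assms(1)]] kept(1) by (auto simp: t_def)
    then show ?thesis
      unfolding t' using kept by (simp add: J0_J1_branch_leaves(1))
  next
    case child
    then have "J0 t u \<union> J1 t u = \<pi> ` {1..i}"
      using Suc.IH[of u] by (auto simp: t_def)
    moreover have "\<pi> ` {1..Suc i} = insert (\<pi> (Suc i)) (\<pi> ` {1..i})"
      by (simp add: atLeastAtMostSuc_conv)
    ultimately show ?thesis
      unfolding t' using child by (auto simp: J0_J1_branch_leaves(2,3))
  qed
qed

section \<open>The size bound\<close>

text \<open>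
  Pad an enumeration of such a subset to a list of length \<open>k\<close> with copies of an element outside the
  set; 0 serves as that element.
\<close>

lemma card_bounded_subsets_le:
  "card {J. J \<subseteq> {1..n} \<and> card J \<le> k} \<le> (n + 1) ^ k"
proof -
  let ?L = "{xs. set xs \<subseteq> {0..n} \<and> length xs = k}"
  have "{J. J \<subseteq> {1..n} \<and> card J \<le> k} \<subseteq> (\<lambda>xs. set xs - {0}) ` ?L"
  proof clarify
    fix J assume J: "J \<subseteq> {1..n}" "card J \<le> k"
    obtain ys where ys: "set ys = J" "distinct ys"
      using finite_distinct_list[of J] J(1) finite_subset by blast
    let ?xs = "ys @ replicate (k - card J) 0"
    have "length ?xs = k"
      using distinct_card[OF ys(2)] ys(1) J(2) by simp
    moreover have "set ?xs \<subseteq> {0..n}" "J = set ?xs - {0}"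
      using ys(1) J(1) by (auto split: if_splits)
    ultimately show "J \<in> (\<lambda>xs. set xs - {0}) ` ?L"
      by blast
  qed
  then have "card {J. J \<subseteq> {1..n} \<and> card J \<le> k} \<le> card ?L"
    by (rule surj_card_le[OF finite_lists_length_eq, rotated]) simp
  then show ?thesis
    by (simp add: card_lists_length_eq)
qed

lemma bb_size_skewed_tree_le:
  assumes "\<pi> permutes {1..n}"
  shows "bb_size (skewed_tree n \<pi> k) \<le> 2 * (n + 1) ^ k"
proof -
  have "card (leaves (skewed_tree n \<pi> k)) = card {J. J \<subseteq> {1..n} \<and> card J \<le> k}"
    using bij_betw_same_card[OF bij_betw_J1_skewed_tree[OF assms]] .
  then show ?thesis
    using Suc_bb_size[of "skewed_tree n \<pi> k"] card_bounded_subsets_le[of n k] by linarith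
qed

lemma two_mult_Suc_power_le:
  fixes n k :: nat
  assumes "n \<ge> 2" and "k \<ge> 1"
  shows "2 * (n + 1) ^ k \<le> n ^ (3 * k)"
proof -
  have "2 \<le> n ^ k"
    using assms self_le_power[of n k] by simp
  moreover have "n + 1 \<le> n ^ 2"
    using assms(1) mult_le_mono1[OF assms(1), of n] unfolding power2_eq_square by linarith
  then have "(n + 1) ^ k \<le> (n ^ 2) ^ k"
    by (rule power_mono) simp
  ultimately have "2 * (n + 1) ^ k \<le> n ^ k * (n ^ 2) ^ k"
    by (rule mult_le_mono)
  also have "\<dots> = n ^ (3 * k)"
    by (simp flip: power_mult power_add)
  finally show ?thesis .
qed

section \<open>Properties of the skewed tree\<close>

theorem theorem3:
  shows "\<exists>C::nat. \<forall>n\<ge>1. \<forall>k\<ge>1. \<forall>\<pi>::nat \<Rightarrow> nat. \<pi> permutes {1..n} \<longrightarrow>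
      (n \<ge> 2 \<longrightarrow> bb_size (skewed_tree n \<pi> k) \<le> n ^ (C * k)) \<and>
      (\<forall>J\<subseteq>{1..n}. card J \<le> k \<longrightarrow>
         (\<exists>!v. v \<in> leaves (skewed_tree n \<pi> k) \<and> J1 (skewed_tree n \<pi> k) v = J)) \<and>
      (\<forall>v\<in>leaves (skewed_tree n \<pi> k).
         card (J1 (skewed_tree n \<pi> k) v) = k \<or>
         J0 (skewed_tree n \<pi> k) v \<union> J1 (skewed_tree n \<pi> k) v = {1..n})"
proof (rule exI[of _ 3], intro allI impI conjI ballI)
  fix n k :: nat and \<pi> :: "nat \<Rightarrow> nat"
  assume k: "k \<ge> 1" and perm: "\<pi> permutes {1..n}"
  show "bb_size (skewed_tree n \<pi> k) \<le> n ^ (3 * k)" if "n \<ge> 2"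
    using bb_size_skewed_tree_le[OF perm] two_mult_Suc_power_le[OF that k] by (rule order_trans)
  show "\<exists>!v. v \<in> leaves (skewed_tree n \<pi> k) \<and> J1 (skewed_tree n \<pi> k) v = J"
    if "J \<subseteq> {1..n}" "card J \<le> k" for J
  proof -
    note bij = bij_betw_J1_skewed_tree[OF perm, of k]
    show ?thesis
    proof (rule ex_ex1I)
      have "J \<in> J1 (skewed_tree n \<pi> k) ` leaves (skewed_tree n \<pi> k)"
        using bij_betw_imp_surj_on[OF bij] that by simp
      then show "\<exists>v. v \<in> leaves (skewed_tree n \<pi> k) \<and> J1 (skewed_tree n \<pi> k) v = J"
        by blast
    qed (use inj_onD[OF bij_betw_imp_inj_on[OF bij]] in simp)
  qed
  show "card (J1 (skewed_tree n \<pi> k) v) = k \<or>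
      J0 (skewed_tree n \<pi> k) v \<union> J1 (skewed_tree n \<pi> k) v = {1..n}"
    if "v \<in> leaves (skewed_tree n \<pi> k)" for v
    using leaf_full_or_all_fixed[OF permutes_inj[OF perm], of v k n] that
    unfolding skewed_tree_def permutes_image[OF perm] .
qed

end
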